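(* For every $N$ and every request sequence $I$ respecting the cycle access graph $C_N$, $$\mathrm{LRU}^{C_N}_W(I)\le \mathrm{FIFO}^{C_N}_W(I).$$
   Context: Paging: a cache of size $k\ge1$, initially empty; on a request to a page not in cache (a fault) the page is brought in, evicting a page if the cache is full; $\mathrm{A}(I)$ is the number of faults of algorithm $\mathrm{A}$ on sequence $I$. LRU evicts the least recently requested page in cache; FIFO evicts the page that has been in cache the longest. An access graph is an undirected graph whose vertices are the pages; a sequence respects it if any two consecutive requests are to the same page or to adjacent vertices. $C_N$ is the cycle graph on $N$ vertices. For an algorithm $\mathrm{A}$ and access graph $G$, $\mathrm{A}^G_W(I)=\max_\sigma \mathrm{A}(\sigma(I))$, the maximum over all permutations $\sigma$ of the requests of $I$ such that $\sigma(I)$ respects $G$. *)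

theory Defs
  imports "HOL-Combinatorics.Permutations"
begin

(* A cache is the list of the pages it holds. The next page to be evicted is the head: under LRU
   the pages are ordered by their most recent request, oldest first; under FIFO they are ordered by
   the time they were brought in, oldest first. *)

definition insert_page :: "nat \<Rightarrow> 'p list \<Rightarrow> 'p \<Rightarrow> 'p list" where
  "insert_page k c p = (if length c < k then c else tl c) @ [p]"

definition lru_step :: "nat \<Rightarrow> 'p list \<Rightarrow> 'p \<Rightarrow> 'p list" where
  "lru_step k c p = (if p \<in> set c then remove1 p c @ [p] else insert_page k c p)"

definition fifo_step :: "nat \<Rightarrow> 'p list \<Rightarrow> 'p \<Rightarrow> 'p list" where
  "fifo_step k c p = (if p \<in> set c then c else insert_page k c p)"

fun faults_from :: "('p list \<Rightarrow> 'p \<Rightarrow> 'p list) \<Rightarrow> 'p list \<Rightarrow> 'p list \<Rightarrow> nat" where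
  "faults_from step c [] = 0"
| "faults_from step c (p # ps) = (if p \<in> set c then 0 else 1) + faults_from step (step c p) ps"

definition LRU :: "nat \<Rightarrow> 'p list \<Rightarrow> nat" where
  "LRU k I = faults_from (lru_step k) [] I"

definition FIFO :: "nat \<Rightarrow> 'p list \<Rightarrow> nat" where
  "FIFO k I = faults_from (fifo_step k) [] I"

(* An undirected graph: vertex set and set of edges, an edge being the set of its endpoints. *)
type_synonym 'p graph = "'p set \<times> 'p set set"

definition respects_graph :: "'p graph \<Rightarrow> 'p list \<Rightarrow> bool" where
  "respects_graph G I \<longleftrightarrow> set I \<subseteq> fst G \<and> successively (\<lambda>u v. u = v \<or> {u, v} \<in> snd G) I"

(* For N = 1 the only edge is a loop and for N = 2 the two edges coincide; neither affects which
   sequences respect the graph. *)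
definition cycle_graph :: "nat \<Rightarrow> nat graph" where
  "cycle_graph N = ({..<N}, {{i, Suc i mod N} | i. i < N})"

(* The set is finite, and it is nonempty whenever I itself respects G; otherwise the value of Max
   is unspecified. *)
definition worst_order :: "('p list \<Rightarrow> nat) \<Rightarrow> 'p graph \<Rightarrow> 'p list \<Rightarrow> nat" where
  "worst_order A G I =
     Max {A (permute_list \<sigma> I) | \<sigma>.
       \<sigma> permutes {..<length I} \<and> respects_graph G (permute_list \<sigma> I)}"

end

theory Submission
  imports Defs
begin

text \<open>
  If at most \<open>k\<close> pages occur, nothing is ever evicted and both algorithms agree. Otherwise \<open>k < N\<close>;
  lift the walk on the cycle to the integers. The cache of LRU is then a window of \<open>k\<close> consecutive
  positions that is pushed along by the walk, one fault per push. On the same sequence FIFO may do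
  better than LRU, for instance when laps are run in both directions. But from the requests of \<open>I\<close> one can
  extract a zigzag walk on which LRU still has at least as many faults and in which every leg except
  the first is at least \<open>k\<close> and less than \<open>N\<close> long: whenever a leg grows to a full lap, this lap is
  cut out and added to the first leg, which saves a turn. On such a zigzag walk the queue of FIFO is
  explicit, and FIFO faults at least as often as LRU. The unused requests are put back as immediate
  repetitions.
\<close>

section \<open>FIFO on stretches of faults and of hits\<close>

lemma faults_from_append:
  "faults_from step c (xs @ ys) =
     faults_from step c xs + faults_from step (foldl step c xs) ys"
  by (induction xs arbitrary: c) auto

text \<open>The form of the FIFO queue along requests that all fault. A list with fewer than
  \<open>k\<close> entries is kept whole.\<close>

definition lastn :: "nat \<Rightarrow> 'a list \<Rightarrow> 'a list" where
  "lastn k xs = drop (length xs - k) xs"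

lemma lastn_snoc:
  assumes "k \<ge> 1"
  shows "insert_page k (lastn k xs) y = lastn k (xs @ [y])"
proof (cases "length xs < k")
  case True
  then show ?thesis by (simp add: lastn_def insert_page_def)
next
  case False
  then show ?thesis using assms
    by (simp add: lastn_def insert_page_def drop_Suc tl_drop[symmetric] Suc_diff_le)
qed

text \<open>\<open>xs\<close> is any list whose last \<open>k\<close> entries form the queue. A
  queue \<open>c\<close> of length \<open>k\<close> is itself \<open>lastn k c\<close>, so the lemma
  can start in the middle of a sequence.\<close>

lemma fifo_all_faults:
  assumes "k \<ge> 1"
    and "\<And>i. i < length ys \<Longrightarrow> ys ! i \<notin> set (lastn k (xs @ take i ys))"
  shows "faults_from (fifo_step k) (lastn k xs) ys = length ys
    \<and> foldl (fifo_step k) (lastn k xs) ys = lastn k (xs @ ys)"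
  using assms(2)
proof (induction ys arbitrary: xs)
  case (Cons y ys)
  have y: "y \<notin> set (lastn k xs)" using Cons.prems[of 0] by simp
  have "faults_from (fifo_step k) (lastn k (xs @ [y])) ys = length ys
    \<and> foldl (fifo_step k) (lastn k (xs @ [y])) ys = lastn k ((xs @ [y]) @ ys)"
  proof (rule Cons.IH)
    fix i assume "i < length ys"
    then show "ys ! i \<notin> set (lastn k ((xs @ [y]) @ take i ys))"
      using Cons.prems[of "Suc i"] by simp
  qed
  moreover have "fifo_step k (lastn k xs) y = lastn k (xs @ [y])"
    using y assms(1) by (simp add: fifo_step_def lastn_snoc)
  ultimately show ?case using y by simp
qed simp

lemma fifo_all_faults_nth:
  assumes "k \<ge> 1"
    and "\<And>i j. length xs \<le> i \<Longrightarrow> i < length (xs @ ys) \<Longrightarrow> j < i \<Longrightarrow> i \<le> j + k \<Longrightarrow>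
      (xs @ ys) ! j \<noteq> (xs @ ys) ! i"
  shows "faults_from (fifo_step k) (lastn k xs) ys = length ys"
    "foldl (fifo_step k) (lastn k xs) ys = lastn k (xs @ ys)"
proof -
  have "ys ! i \<notin> set (lastn k (xs @ take i ys))" if i: "i < length ys" for i
  proof
    let ?n = "length xs + i"
    have take: "xs @ take i ys = take ?n (xs @ ys)" using i by simp
    assume "ys ! i \<in> set (lastn k (xs @ take i ys))"
    then obtain m where m: "m < length (lastn k (take ?n (xs @ ys)))"
      "lastn k (take ?n (xs @ ys)) ! m = ys ! i" unfolding take by (metis in_set_conv_nth)
    define j where "j = ?n - k + m"
    have len: "length (take ?n (xs @ ys)) = ?n" using i by simp
    have j: "j < ?n" "?n \<le> j + k" using m(1) len by (auto simp: lastn_def j_def)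
    have "lastn k (take ?n (xs @ ys)) ! m = take ?n (xs @ ys) ! j"
      using len by (simp add: lastn_def j_def del: take_append length_take length_append)
    also have "\<dots> = (xs @ ys) ! j" using j(1) by (rule nth_take)
    finally have "(xs @ ys) ! j = (xs @ ys) ! ?n" using m(2) by (metis nth_append_length_plus)
    then show False using assms(2)[of ?n j] j i by simp
  qed
  then show "faults_from (fifo_step k) (lastn k xs) ys = length ys"
    "foldl (fifo_step k) (lastn k xs) ys = lastn k (xs @ ys)"
    using fifo_all_faults[OF assms(1), of ys xs] by auto
qed

lemma fifo_all_hits:
  assumes "set ys \<subseteq> set c"
  shows "faults_from (fifo_step k) c ys = 0 \<and> foldl (fifo_step k) c ys = c"
  using assms by (induction ys) (auto simp: fifo_step_def)

lemma mem_fifo_step: "p \<in> set (fifo_step k c p)"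
  by (simp add: fifo_step_def insert_page_def)

section \<open>Caches with room for all pages\<close>

text \<open>A faulting page lies outside the cache, and together they are among at most
  \<open>k\<close> pages, so there is room. Nothing is evicted, and the two caches differ only in
  order.\<close>

lemma lru_eq_fifo_from:
  assumes "set c = set c'" "distinct c" "distinct c'" "card (set c \<union> set I) \<le> k"
  shows "faults_from (lru_step k) c I = faults_from (fifo_step k) c' I"
  using assms
proof (induction I arbitrary: c c')
  case (Cons p I)
  have len: "length c = card (set c)" "length c' = card (set c)"
    using Cons.prems by (metis distinct_card)+
  show ?case
  proof (cases "p \<in> set c")
    case True
    have "faults_from (lru_step k) (lru_step k c p) I = faults_from (fifo_step k) (fifo_step k c' p) I"
      by (rule Cons.IH) (use True Cons.prems in \<open>auto simp: lru_step_def fifo_step_def insert_absorb\<close>)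
    then show ?thesis using True Cons.prems by simp
  next
    case False
    have "card (insert p (set c)) \<le> card (set c \<union> set (p # I))" by (intro card_mono) auto
    then have "length c < k" "length c' < k" using False Cons.prems(4) len by auto
    then have "faults_from (lru_step k) (lru_step k c p) I = faults_from (fifo_step k) (fifo_step k c' p) I"
      by (intro Cons.IH)
        (use False Cons.prems in \<open>auto simp: lru_step_def fifo_step_def insert_page_def\<close>)
    then show ?thesis using False Cons.prems by simp
  qed
qed simp

lemma LRU_eq_FIFO_if_few_pages: "card (set I) \<le> k \<Longrightarrow> LRU k I = FIFO k I"
  unfolding LRU_def FIFO_def by (rule lru_eq_fifo_from) auto

section \<open>Repetitions and reorderings of requests\<close>

lemma FIFO_duplicate: "FIFO k (xs @ v # v # ys) = FIFO k (xs @ v # ys)"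
proof -
  have "fifo_step k (fifo_step k c v) v = fifo_step k c v" for c :: "'a list"
    using mem_fifo_step[of v k c] by (metis fifo_step_def)
  then show ?thesis
    by (simp add: FIFO_def faults_from_append mem_fifo_step)
qed

lemma respects_graph_duplicate:
  "respects_graph G (xs @ v # ys) \<Longrightarrow> respects_graph G (xs @ v # v # ys)"
  by (auto simp: respects_graph_def successively_append_iff)

text \<open>Requests not needed by \<open>J\<close> can be absorbed as immediate repetitions, which are hits.\<close>

lemma pad_with_hits:
  assumes "mset J \<subseteq># mset I" "set I \<subseteq> set J" "respects_graph G J"
  shows "\<exists>J'. mset J' = mset I \<and> respects_graph G J' \<and> FIFO k J' = FIFO k J"
  using assms
proof (induction "size (mset I - mset J)" arbitrary: J)
  case 0
  then have "mset J = mset I"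
    by (metis size_eq_0_iff_empty subset_mset.add_diff_inverse add.right_neutral)
  then show ?case using 0 by blast
next
  case (Suc n)
  then obtain v where v: "v \<in># mset I - mset J"
    by (metis size_eq_Suc_imp_elem)
  then have "v \<in> set J" using Suc.prems(2) by (metis in_diffD set_mset_mset subsetD)
  then obtain xs ys where J: "J = xs @ v # ys" by (meson split_list)
  let ?J = "xs @ v # v # ys"
  have m: "mset ?J = add_mset v (mset J)" using J by simp
  have "mset I - mset ?J = mset I - mset J - {#v#}"
    unfolding m by (metis add_mset_add_single diff_diff_add)
  then have "n = size (mset I - mset ?J)"
    using size_Suc_Diff1[OF v] Suc.hyps(2) by (metis nat.inject)
  moreover have "mset ?J \<subseteq># mset I"
    unfolding m using v Suc.prems(1)
    by (metis add_mset_add_single insert_subset_eq_iff subset_mset.le_diff_conv2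
        single_subset_iff union_commute)
  moreover have "set I \<subseteq> set ?J" using Suc.prems J by auto
  moreover have "respects_graph G ?J" using respects_graph_duplicate[of G xs v ys] Suc.prems(3) J by simp
  ultimately show ?case using Suc.hyps(1)[of ?J] FIFO_duplicate J by metis
qed

text \<open>The maxima range over finite sets, and the identity permutation makes the first one
  nonempty. So the first maximum is attained, and comparing single sequences suffices.\<close>

lemma worst_order_mono:
  assumes "respects_graph G I"
    and "\<And>I'. mset I' = mset I \<Longrightarrow> respects_graph G I' \<Longrightarrow>
      \<exists>J. mset J = mset I \<and> respects_graph G J \<and> A I' \<le> B J"
  shows "worst_order A G I \<le> worst_order B G I"
proof -
  define S where "S A = {A (permute_list \<sigma> I) | \<sigma>.
       \<sigma> permutes {..<length I} \<and> respects_graph G (permute_list \<sigma> I)}" for A :: "'a list \<Rightarrow> nat"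
  have fin: "finite (S A)" for A
  proof -
    have "S A \<subseteq> (\<lambda>\<sigma>. A (permute_list \<sigma> I)) ` {\<sigma>. \<sigma> permutes {..<length I}}"
      unfolding S_def by blast
    then show ?thesis by (rule finite_subset) (simp add: finite_permutations)
  qed
  have "S A \<noteq> {}"
  proof -
    have "A (permute_list id I) \<in> S A"
      unfolding S_def using assms(1) permutes_id[of "{..<length I}"]
      by (intro CollectI exI[of _ id]) simp
    then show ?thesis by blast
  qed
  then have "Max (S A) \<in> S A" using fin Max_in by blast
  then obtain \<sigma> where \<sigma>: "Max (S A) = A (permute_list \<sigma> I)" "\<sigma> permutes {..<length I}"
    "respects_graph G (permute_list \<sigma> I)" unfolding S_def by blast
  then obtain J where J: "mset J = mset I" "respects_graph G J" "A (permute_list \<sigma> I) \<le> B J"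
    using assms(2)[of "permute_list \<sigma> I"] by auto
  obtain \<tau> where "\<tau> permutes {..<length I}" "permute_list \<tau> I = J"
    using mset_eq_permutation[OF J(1)] by metis
  then have "B J \<in> S B" unfolding S_def using J(2) by blast
  then have "B J \<le> Max (S B)" using fin by simp
  then show ?thesis using J(3) \<sigma>(1) unfolding worst_order_def S_def by simp
qed

section \<open>The covering of the cycle by the integers\<close>

locale cycle_paging =
  fixes N k :: nat
  assumes k_pos: "k \<ge> 1" and k_less: "k < N"
begin

text \<open>The covering map from the integers to the cycle. On the integers laps are told apart,
  and the pages in a cache can be described by an interval.\<close>

definition page :: "int \<Rightarrow> nat" where
  "page x = nat (x mod int N)"

lemma N_pos: "int N > 0" using k_less by simp

lemma page_less: "page x < N"
  using N_pos by (simp add: page_def nat_less_iff)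

lemma page_eq_iff: "page x = page y \<longleftrightarrow> x mod int N = y mod int N"
proof -
  have "int (page z) = z mod int N" for z using N_pos by (simp add: page_def)
  then show ?thesis by (metis of_nat_eq_iff)
qed

lemma page_inj: "page x = page y \<Longrightarrow> \<bar>x - y\<bar> < int N \<Longrightarrow> x = y"
  unfolding page_eq_iff by (metis mod_eq_dvd_iff dvd_imp_le_int right_minus_eq abs_of_nat not_le)

lemma page_of_nat: "i < N \<Longrightarrow> page (int i) = i"
  by (simp add: page_def)

abbreviation adjacent :: "nat \<Rightarrow> nat \<Rightarrow> bool" where
  "adjacent u v \<equiv> u = v \<or> {u, v} \<in> snd (cycle_graph N)"

lemma page_succ: "page (x + 1) = Suc (page x) mod N"
proof -
  have "int (Suc (page x) mod N) = (x mod int N + 1) mod int N"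
    using N_pos by (simp add: page_def zmod_int add.commute)
  also have "\<dots> = int (page (x + 1))" using N_pos by (simp add: page_def mod_add_left_eq)
  finally show ?thesis by linarith
qed

lemma edge_page: "{page x, page (x + 1)} \<in> snd (cycle_graph N)"
  using page_less[of x] page_succ[of x] by (auto simp: cycle_graph_def)

lemma adjacent_page:
  assumes "\<bar>x - y\<bar> \<le> 1"
  shows "adjacent (page x) (page y)"
proof -
  consider "y = x" | "y = x + 1" | "x = y + 1" using assms by linarith
  then show ?thesis using edge_page[of x] edge_page[of y] by cases (auto simp: insert_commute)
qed

text \<open>Path lifting for a single step; iterated, it turns a walk on the cycle into one on the
  integers.\<close>

lemma adjacent_lift:
  assumes "adjacent (page p) v" "v < N"
  shows "\<exists>\<delta>. (\<delta> = -1 \<or> \<delta> = 0 \<or> \<delta> = 1) \<and> v = page (p + \<delta>)"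
proof -
  consider "v = page p" | i where "i < N" "{page p, v} = {i, Suc i mod N}"
    using assms(1) by (auto simp: cycle_graph_def)
  then show ?thesis
  proof cases
    case 1
    then show ?thesis by (intro exI[of _ 0]) simp
  next
    case 2
    then consider "page p = i" "v = Suc i mod N" | "v = i" "page p = Suc i mod N"
      by (auto simp: doubleton_eq_iff)
    then show ?thesis
    proof cases
      case 1
      then show ?thesis using page_succ[of p] 2 by (intro exI[of _ 1]) simp
    next
      case 3: 2
      then have "page p = page (int i + 1)" using page_succ[of "int i"] 2 page_of_nat by simp
      then have "page (p - 1) = page (int i)"
        unfolding page_eq_iff by (metis add_diff_cancel_right' mod_diff_left_eq)
      then show ?thesis using 3 2 page_of_nat by (intro exI[of _ "-1"]) simp
    qed
  qed
qed

section \<open>The LRU cache as a sliding window\<close>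

text \<open>\<open>z\<close> lists the cached positions, least recently requested first. The order
  condition says that on each side of \<open>p\<close> farther positions are older; positions on
  opposite sides may come in any order.\<close>

definition lru_window :: "int \<Rightarrow> int \<Rightarrow> int \<Rightarrow> nat list \<Rightarrow> bool" where
  "lru_window a b p c \<longleftrightarrow> a \<le> p \<and> p \<le> b \<and>
     (\<exists>z. c = map page z \<and> distinct z \<and> set z = {a..b} \<and>
        sorted_wrt (\<lambda>x y. \<not> (y < x \<and> x \<le> p) \<and> \<not> (x < y \<and> p \<le> x)) z)"

text \<open>A position at most one step outside the window is less than a full lap away from all
  positions in it, because \<open>k < N\<close>.\<close>

lemma page_mem_window:
  assumes "set z = {a..b}" "b - a < int k" "a - 1 \<le> x" "x \<le> b + 1"
  shows "page x \<in> page ` set z \<longleftrightarrow> x \<in> {a..b}"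
proof
  assume "page x \<in> page ` set z"
  then obtain y where "y \<in> {a..b}" "page x = page y" using assms(1) by auto
  moreover have "\<bar>x - y\<bar> < int N" using calculation(1) assms k_less by auto
  ultimately show "x \<in> {a..b}" using page_inj by blast
qed (use assms in auto)

lemma lru_window_hit:
  assumes "lru_window a b p c" "b - a < int k" "\<bar>\<delta>\<bar> \<le> 1" "a \<le> p + \<delta>" "p + \<delta> \<le> b"
  shows "page (p + \<delta>) \<in> set c" "lru_window a b (p + \<delta>) (lru_step k c (page (p + \<delta>)))"
proof -
  let ?x = "p + \<delta>"
  obtain z where z: "c = map page z" "distinct z" "set z = {a..b}"
    "sorted_wrt (\<lambda>x y. \<not> (y < x \<and> x \<le> p) \<and> \<not> (x < y \<and> p \<le> x)) z"
    using assms(1) by (auto simp: lru_window_def)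
  have inj: "inj_on page {a..b}"
    by (rule inj_onI) (use assms(2) k_less in \<open>auto intro!: page_inj\<close>)
  have mem: "?x \<in> set z" using z assms by simp
  then show c: "page ?x \<in> set c" using z by simp
  define z' where "z' = filter (\<lambda>y. y \<noteq> ?x) z @ [?x]"
  have "distinct (map page z)" using z(2,3) inj by (simp add: distinct_map)
  then have "remove1 (page ?x) (map page z) = filter (\<lambda>v. v \<noteq> page ?x) (map page z)"
    by (rule distinct_remove1_removeAll[THEN trans]) (simp add: removeAll_filter_not_eq neq_commute)
  also have "\<dots> = map page (filter (\<lambda>y. y \<noteq> ?x) z)"
    unfolding filter_map comp_def
    by (intro arg_cong[of _ _ "map page"] filter_cong refl) (use inj z(3) mem in \<open>auto dest: inj_onD\<close>)
  finally have "remove1 (page ?x) (map page z) = map page (filter (\<lambda>y. y \<noteq> ?x) z)" .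
  then have "lru_step k c (page ?x) = map page z'" using c z by (simp add: lru_step_def z'_def)
  moreover have "distinct z'" using z(2) by (simp add: z'_def)
  moreover have "set z' = set z" using mem by (auto simp: z'_def)
  then have "set z' = {a..b}" using z(3) by simp
  moreover have "sorted_wrt (\<lambda>x y. \<not> (y < x \<and> x \<le> ?x) \<and> \<not> (x < y \<and> ?x \<le> x)) z'"
    unfolding z'_def sorted_wrt_append
  proof (intro conjI)
    show "sorted_wrt (\<lambda>x y. \<not> (y < x \<and> x \<le> ?x) \<and> \<not> (x < y \<and> ?x \<le> x)) (filter (\<lambda>y. y \<noteq> ?x) z)"
    proof (rule sorted_wrt_mono_rel[OF _ sorted_wrt_filter[OF z(4)]])
      \<comment> \<open>The centre moves by at most one, so an \<open>x\<close> other than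
        \<open>?x\<close> on one side of \<open>?x\<close> was on the same side of \<open>p\<close>,
        where \<open>p\<close> itself counts for both sides.\<close>
      fix x y assume "x \<in> set (filter (\<lambda>y. y \<noteq> ?x) z)"
        "\<not> (y < x \<and> x \<le> p) \<and> \<not> (x < y \<and> p \<le> x)"
      moreover from this have "x \<noteq> ?x" by simp
      ultimately show "\<not> (y < x \<and> x \<le> ?x) \<and> \<not> (x < y \<and> ?x \<le> x)" using assms(3) by arith
    qed
  qed auto
  ultimately show "lru_window a b ?x (lru_step k c (page ?x))"
    unfolding lru_window_def using assms by blast
qed

text \<open>The walk leaves the window at one end. A cache with room grows by that position; a full
  one evicts the opposite end, so the window shifts by \<open>\<delta>\<close>.\<close>

lemma lru_window_fault:
  assumes "lru_window a b p c" "b - a < int k" "\<bar>\<delta>\<bar> \<le> 1" "\<not> (a \<le> p + \<delta> \<and> p + \<delta> \<le> b)"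
  shows "page (p + \<delta>) \<notin> set c"
    "b - a + 1 < int k \<Longrightarrow>
      lru_window (min a (p + \<delta>)) (max b (p + \<delta>)) (p + \<delta>) (lru_step k c (page (p + \<delta>)))"
    "b - a + 1 = int k \<Longrightarrow> lru_window (a + \<delta>) (b + \<delta>) (p + \<delta>) (lru_step k c (page (p + \<delta>)))"
proof -
  let ?x = "p + \<delta>"
  let ?R = "\<lambda>p x y. \<not> (y < x \<and> x \<le> p) \<and> \<not> (x < y \<and> p \<le> (x::int))"
  obtain z where z: "c = map page z" "distinct z" "set z = {a..b}" "sorted_wrt (?R p) z"
    and p: "a \<le> p" "p \<le> b"
    using assms(1) by (auto simp: lru_window_def)
  have nmem: "?x \<notin> set z" using z assms by simp
  show c: "page ?x \<notin> set c"
    using page_mem_window[OF z(3) assms(2), of ?x] nmem z(1,3) p assms(3) by auto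
  have len: "int (length z) = b - a + 1" using z(2,3) p distinct_card[of z] by simp
  have sorted: "sorted_wrt (?R ?x) (ws @ [?x])" if "sorted_wrt (?R p) ws" "?x \<notin> set ws" for ws
    unfolding sorted_wrt_append
  proof (intro conjI)
    show "sorted_wrt (?R ?x) ws"
    proof (rule sorted_wrt_mono_rel[OF _ that(1)])
      fix x y assume "x \<in> set ws" "?R p x y"
      moreover from this have "x \<noteq> ?x" using that(2) by metis
      ultimately show "?R ?x x y" using assms(3) by arith
    qed
  qed (use that in auto)
  have ends: "\<delta> = 1 \<and> p = b \<or> \<delta> = -1 \<and> p = a" using assms p by auto
  {
    assume "b - a + 1 < int k"
    then have "lru_step k c (page ?x) = map page (z @ [?x])"
      using c z(1) len by (simp add: lru_step_def insert_page_def)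
    moreover have "set (z @ [?x]) = {min a ?x..max b ?x}"
      unfolding set_append z(3) using ends p by auto
    moreover have "distinct (z @ [?x])" using z(2) nmem by simp
    ultimately show "lru_window (min a ?x) (max b ?x) ?x (lru_step k c (page ?x))"
      unfolding lru_window_def using sorted[OF z(4) nmem] by (intro conjI exI[of _ "z @ [?x]"]) auto
  }
  {
    assume full: "b - a + 1 = int k"
    then have "lru_step k c (page ?x) = map page (tl z @ [?x])"
      using c z(1) len by (simp add: lru_step_def insert_page_def map_tl)
    moreover have "set (tl z @ [?x]) = {a + \<delta>..b + \<delta>}" "distinct (tl z @ [?x])"
      "sorted_wrt (?R ?x) (tl z @ [?x])"
    proof -
      obtain h ys where hy: "z = h # ys" using z(3) p by (cases z) auto
      have h: "h \<in> {a..b}" "\<And>y. y \<in> {a..b} \<Longrightarrow> y \<noteq> h \<Longrightarrow> ?R p h y"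
      proof -
        show "h \<in> {a..b}" unfolding z(3)[symmetric] hy by simp
        show "?R p h y" if "y \<in> {a..b}" "y \<noteq> h" for y
          using that z(4) unfolding z(3)[symmetric] hy by auto
      qed
      \<comment> \<open>All positions lie on one side of \<open>p\<close>, so the oldest one is the
        farthest from \<open>p\<close>.\<close>
      have hh: "h = (if \<delta> = 1 then a else b)"
        using ends h(1) h(2)[of a] h(2)[of b] p by (auto split: if_splits)
      have "set ys = set z - {h}" using hy z(2) by auto
      then have "set ys = {a..b} - {h}" using z(3) by simp
      then have "set (tl z @ [?x]) = insert ?x ({a..b} - {h})" using hy by simp
      also have "\<dots> = {a + \<delta>..b + \<delta>}" using hh ends p by auto
      finally show "set (tl z @ [?x]) = {a + \<delta>..b + \<delta>}" .
      show "distinct (tl z @ [?x])" using hy nmem z(2) by auto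
      show "sorted_wrt (?R ?x) (tl z @ [?x])" by (rule sorted) (use hy nmem z(4) in auto)
    qed
    ultimately show "lru_window (a + \<delta>) (b + \<delta>) ?x (lru_step k c (page ?x))"
      unfolding lru_window_def using ends p by (intro conjI exI[of _ "tl z @ [?x]"]) auto
  }
qed

section \<open>Zigzag walks and their laps\<close>

text \<open>The page \<open>i\<close> steps back from \<open>e\<close>, which was reached in
  direction \<open>\<sigma>\<close>. The same indices describe the way to \<open>e\<close> and the
  leg that follows a turn at \<open>e\<close>.\<close>

definition behind :: "int \<Rightarrow> int \<Rightarrow> nat \<Rightarrow> nat" where
  "behind e \<sigma> i = page (e - \<sigma> * int i)"

lemma behind_lap: "behind (e + c * int N) \<sigma> i = behind e \<sigma> i"
proof -
  have "e + c * int N - \<sigma> * int i = (e - \<sigma> * int i) + c * int N" by simp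
  then show ?thesis unfolding behind_def page_eq_iff by (metis mod_mult_self1)
qed

text \<open>The change of coordinates at the end of a leg of length \<open>d\<close>, from where the
  leg is read in reverse.\<close>

lemma behind_reverse: "i \<le> d \<Longrightarrow> behind (e - \<sigma> * int d) (-\<sigma>) i = behind e \<sigma> (d - i)"
  by (simp add: behind_def of_nat_diff algebra_simps)

lemma behind_inj:
  assumes "\<sigma> = 1 \<or> \<sigma> = -1" "behind e \<sigma> i = behind e \<sigma> j" "i < j + N" "j < i + N"
  shows "i = j"
proof -
  have "e - \<sigma> * int i = e - \<sigma> * int j"
    by (rule page_inj) (use assms in \<open>auto simp: behind_def\<close>)
  then show ?thesis using assms(1) by auto
qed

text \<open>\<open>N\<close> consecutive positions meet every page once, so the requests of a lap
  depend neither on its start nor on its direction.\<close>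

lemma mset_lap:
  assumes "\<sigma> = 1 \<or> \<sigma> = -1"
  shows "mset (map (behind e \<sigma>) [m..<m + N]) = mset_set {..<N}"
proof -
  have "inj_on (behind e \<sigma>) {m..<m + N}"
    by (rule inj_onI) (use behind_inj[OF assms] in auto)
  then have "distinct (map (behind e \<sigma>) [m..<m + N])" "card (behind e \<sigma> ` {m..<m + N}) = N"
    by (simp_all add: distinct_map card_image)
  moreover have "behind e \<sigma> ` {m..<m + N} \<subseteq> {..<N}" using page_less by (auto simp: behind_def)
  ultimately have "behind e \<sigma> ` {m..<m + N} = {..<N}" by (intro card_subset_eq) auto
  then show ?thesis using \<open>distinct _\<close> by (metis mset_set_set set_map set_upt)
qed

text \<open>\<open>zigzag J V e \<sigma>\<close>: the walk \<open>J\<close> runs in one direction and then traverses legs of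
  alternating direction, each of length at least \<open>k\<close> and less than a full lap; it arrives at
  position \<open>e\<close> in direction \<open>\<sigma>\<close>. Every turn costs LRU \<open>k - 1\<close> hits, so that \<open>V\<close> is the number
  of faults of LRU on \<open>J\<close>.\<close>

inductive zigzag :: "nat list \<Rightarrow> int \<Rightarrow> int \<Rightarrow> int \<Rightarrow> bool" where
  run: "k \<le> L \<Longrightarrow> \<sigma> = 1 \<or> \<sigma> = -1 \<Longrightarrow> zigzag (map (behind e \<sigma>) (rev [0..<L])) (int L) e \<sigma>"
| turn: "zigzag J V e \<sigma> \<Longrightarrow> k \<le> d \<Longrightarrow> d < N \<Longrightarrow>
    zigzag (J @ map (behind e \<sigma>) [1..<Suc d]) (V + int d - (int k - 1)) (e - \<sigma> * int d) (-\<sigma>)"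

lemma zigzag_dir: "zigzag J V e \<sigma> \<Longrightarrow> \<sigma> = 1 \<or> \<sigma> = -1"
  by (induction rule: zigzag.induct) auto

text \<open>Cutting out a lap moves the lifted end by \<open>N\<close>, so zigzag walks must be
  movable by whole laps.\<close>

lemma zigzag_shift: "zigzag J V e \<sigma> \<Longrightarrow> zigzag J V (e + c * int N) \<sigma>"
proof (induction rule: zigzag.induct)
  case (run L \<sigma> e)
  have "behind (e + c * int N) \<sigma> = behind e \<sigma>" using behind_lap by blast
  then show ?case using zigzag.run[OF run, of "e + c * int N"] by simp
next
  case (turn J V e \<sigma> d)
  have "behind (e + c * int N) \<sigma> = behind e \<sigma>" using behind_lap by blast
  then show ?case using zigzag.turn[OF turn.IH turn.hyps(2,3)]
    by (simp add: algebra_simps)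
qed

text \<open>Laps may be moved to the initial run, since reversing a closed walk preserves the pages
  requested.\<close>

lemma zigzag_add_lap:
  "zigzag J V e \<sigma> \<Longrightarrow> \<exists>J'. zigzag J' (V + int N) e \<sigma> \<and> mset J' = mset J + mset_set {..<N}"
proof (induction rule: zigzag.induct)
  case (run L \<sigma> e)
  have "[0..<L + N] = [0..<L] @ [L..<L + N]" by (rule upt_add_eq_append) simp
  then have "mset (map (behind e \<sigma>) (rev [0..<L + N])) =
      mset (map (behind e \<sigma>) (rev [0..<L])) + mset_set {..<N}"
    using mset_lap[OF run(2), of e L] by simp
  moreover have "zigzag (map (behind e \<sigma>) (rev [0..<L + N])) (int L + int N) e \<sigma>"
    using zigzag.run[of "L + N" \<sigma> e] run by simp
  ultimately show ?case by blast
next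
  case (turn J V e \<sigma> d)
  then obtain J' where J': "zigzag J' (V + int N) e \<sigma>" "mset J' = mset J + mset_set {..<N}"
    by blast
  show ?case
  proof (intro exI conjI)
    show "zigzag (J' @ map (behind e \<sigma>) [1..<Suc d]) (V + int d - (int k - 1) + int N) (e - \<sigma> * int d) (-\<sigma>)"
      using zigzag.turn[OF J'(1) turn.hyps(2,3)] by (simp add: algebra_simps)
  qed (use J'(2) in simp)
qed

text \<open>The last leg, or the initial run, is prolonged by one. A leg that thereby becomes a full
  lap is moved to the initial run, and the walk then arrives in the direction of the previous
  leg.\<close>

lemma zigzag_straight:
  assumes "zigzag J V e \<sigma>"
  shows "\<exists>J' V' \<sigma>'. zigzag J' V' (e + \<sigma>) \<sigma>' \<and> mset J' = add_mset (page (e + \<sigma>)) (mset J) \<and>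
    (\<sigma>' = \<sigma> \<and> V' = V + 1 \<or> \<sigma>' = -\<sigma> \<and> V' = V + int k)"
  using assms
proof cases
  case (run L)
  have "map (behind (e + \<sigma>) \<sigma>) [1..<Suc L] = map (behind e \<sigma>) [0..<L]"
    unfolding upt_conv_Cons_Cons map_Suc_upt[symmetric] One_nat_def
    by (simp add: behind_def algebra_simps comp_def)
  then have "map (behind (e + \<sigma>) \<sigma>) [0..<Suc L] = page (e + \<sigma>) # map (behind e \<sigma>) [0..<L]"
    by (subst upt_rec) (simp add: behind_def del: upt_Suc)
  then have "mset (map (behind (e + \<sigma>) \<sigma>) (rev [0..<Suc L])) = add_mset (page (e + \<sigma>)) (mset J)"
    using run(1) by (simp only: rev_map[symmetric] mset_rev) simp
  moreover have "zigzag (map (behind (e + \<sigma>) \<sigma>) (rev [0..<Suc L])) (V + 1) (e + \<sigma>) \<sigma>"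
    using zigzag.run[of "Suc L" \<sigma> "e + \<sigma>"] run by (simp add: add.commute del: upt_Suc)
  ultimately show ?thesis by blast
next
  case (turn J0 V0 e0 \<sigma>0 d)
  have e: "e + \<sigma> = e0 - \<sigma>0 * int (Suc d)" using turn by (simp add: algebra_simps)
  then have p: "page (e + \<sigma>) = behind e0 \<sigma>0 (Suc d)" by (simp add: behind_def)
  show ?thesis
  proof (cases "Suc d < N")
    case True
    have "zigzag (J0 @ map (behind e0 \<sigma>0) [1..<Suc (Suc d)]) (V + 1) (e + \<sigma>) \<sigma>"
    proof -
      have V: "V + 1 = V0 + int (Suc d) - (int k - 1)" using turn(2) by simp
      show ?thesis unfolding e V unfolding turn(4)
        by (rule zigzag.turn[OF turn(5)]) (use True turn(6) in auto)
    qed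
    moreover have "mset (J0 @ map (behind e0 \<sigma>0) [1..<Suc (Suc d)]) = add_mset (page (e + \<sigma>)) (mset J)"
      unfolding p turn(1) by simp
    ultimately show ?thesis by blast
  next
    case False
    then have N: "N = Suc d" using turn by simp
    obtain J' where J': "zigzag J' (V0 + int N) e0 \<sigma>0" "mset J' = mset J0 + mset_set {..<N}"
      using zigzag_add_lap[OF turn(5)] by blast
    \<comment> \<open>The value rises by 1 for the new request and by \<open>k - 1\<close> for the
      turn that is saved.\<close>
    have "e0 + -\<sigma>0 * int N = e + \<sigma>" "V0 + int N = V + int k" "-\<sigma> = \<sigma>0"
      using turn(2,4) e N by simp_all
    then have "zigzag J' (V + int k) (e + \<sigma>) (-\<sigma>)"
      using zigzag_shift[OF J'(1), of "-\<sigma>0"] by (simp only:)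
    moreover have "mset J' = add_mset (page (e + \<sigma>)) (mset J)"
    proof -
      have "1 + N = Suc (Suc d)" using N by simp
      then have "mset (map (behind e0 \<sigma>0) [1..<Suc (Suc d)]) = mset_set {..<N}"
        using mset_lap[OF zigzag_dir[OF turn(5)], of e0 1] by (simp only:)
      then show ?thesis unfolding p turn(1) J'(2) by (auto simp flip: \<open>mset _ = mset_set {..<N}\<close>)
    qed
    ultimately show ?thesis by blast
  qed
qed

text \<open>The initial run and every leg have at least \<open>k\<close> requests, so the last
  \<open>k\<close> positions are all requested on the last of them.\<close>

lemma zigzag_window: "zigzag J V e \<sigma> \<Longrightarrow> i < k \<Longrightarrow> behind e \<sigma> i \<in> set J"
proof (induction rule: zigzag.cases)
  case (turn J V e \<sigma> d)
  then have "behind (e - \<sigma> * int d) (-\<sigma>) i = behind e \<sigma> (d - i)" by (intro behind_reverse) simp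
  moreover have "d - i \<in> set [1..<Suc d]" using turn by auto
  ultimately show ?case using turn by auto
qed auto

lemma successively_map_upt:
  "(\<And>i. P (f i) (f (Suc i))) \<Longrightarrow> successively P (map f [a..<b])"
proof (induction b)
  case (Suc b)
  show ?case
  proof (cases "a < b")
    case True
    then have "last (map f [a..<b]) = f (b - 1)" by (simp add: last_map)
    then show ?thesis using Suc True Suc.prems[of "b - 1"] by (auto simp: successively_append_iff)
  qed auto
qed simp

lemma zigzag_respects:
  assumes "zigzag J V e \<sigma>"
  shows "respects_graph (cycle_graph N) J"
proof -
  have adj: "adjacent (behind e \<sigma> i) (behind e \<sigma> (Suc i))" "adjacent (behind e \<sigma> (Suc i)) (behind e \<sigma> i)"
    if "\<sigma> = 1 \<or> \<sigma> = -1" for e \<sigma> i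
    using adjacent_page[of "e - \<sigma> * int i" "e - \<sigma> * int (Suc i)"] that
    unfolding behind_def by (auto simp: insert_commute)
  have less: "behind e \<sigma> i < N" for e \<sigma> i using page_less by (simp add: behind_def)
  \<comment> \<open>The end \<open>page e\<close> is carried along because the next leg starts
    beside it.\<close>
  have "J \<noteq> [] \<and> last J = page e \<and> set J \<subseteq> {..<N} \<and> successively adjacent J"
    using assms
  proof (induction rule: zigzag.induct)
    case (run L \<sigma> e)
    have "successively (\<lambda>u v. adjacent v u) (map (behind e \<sigma>) [0..<L])"
      by (rule successively_map_upt) (rule adj(2)[OF run(2)])
    then have "successively adjacent (map (behind e \<sigma>) (rev [0..<L]))"
      by (simp only: rev_map[symmetric] successively_rev)
    moreover have "last (map (behind e \<sigma>) (rev [0..<L])) = behind e \<sigma> 0" "L > 0"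
      using run k_pos by (auto simp: last_map last_rev hd_upt)
    ultimately show ?case using less by (auto simp: behind_def)
  next
    case (turn J V e \<sigma> d)
    have \<sigma>: "\<sigma> = 1 \<or> \<sigma> = -1" using turn zigzag_dir by blast
    have d: "1 < Suc d" using turn k_pos by simp
    have "successively adjacent (map (behind e \<sigma>) [1..<Suc d])"
      by (rule successively_map_upt) (rule adj(1)[OF \<sigma>])
    moreover have "hd (map (behind e \<sigma>) [1..<Suc d]) = behind e \<sigma> (Suc 0)"
      using d by (simp add: hd_map del: upt_Suc)
    moreover have "last J = behind e \<sigma> 0" using turn by (simp add: behind_def)
    moreover have "last (map (behind e \<sigma>) [1..<Suc d]) = page (e - \<sigma> * int d)"
      using d by (simp add: behind_def)
    ultimately show ?case using turn.IH d less adj(1)[OF \<sigma>, of e 0]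
      by (auto simp: successively_append_iff simp del: upt_Suc)
  qed
  then show ?thesis by (auto simp: respects_graph_def cycle_graph_def)
qed

section \<open>FIFO on zigzag walks\<close>

text \<open>Since \<open>k < N\<close>, any \<open>k + 1\<close> consecutive requests of a run are
  distinct, so all of them fault.\<close>

lemma fifo_run:
  assumes "k \<le> L" "\<sigma> = 1 \<or> \<sigma> = -1"
  shows "FIFO k (map (behind e \<sigma>) (rev [0..<L])) = L"
    "foldl (fifo_step k) [] (map (behind e \<sigma>) (rev [0..<L])) = map (behind e \<sigma>) (rev [0..<k])"
proof -
  let ?ys = "map (behind e \<sigma>) (rev [0..<L])"
  have "([] @ ?ys) ! j \<noteq> ([] @ ?ys) ! i" if "i < length ([] @ ?ys)" "j < i" "i \<le> j + k" for i j
  proof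
    assume "([] @ ?ys) ! j = ([] @ ?ys) ! i"
    then have "behind e \<sigma> (L - Suc j) = behind e \<sigma> (L - Suc i)" using that by (simp add: rev_nth)
    then have "L - Suc j = L - Suc i" by (rule behind_inj[OF assms(2)]) (use that k_less in auto)
    then show False using that by simp
  qed
  then have "faults_from (fifo_step k) (lastn k []) ?ys = length ?ys"
    "foldl (fifo_step k) (lastn k []) ?ys = lastn k ([] @ ?ys)"
    by (intro fifo_all_faults_nth k_pos; blast)+
  moreover have "lastn k ?ys = map (behind e \<sigma>) (rev [0..<k])"
    using assms(1) by (simp add: lastn_def drop_map drop_rev take_upt)
  ultimately show "FIFO k ?ys = L" "foldl (fifo_step k) [] ?ys = map (behind e \<sigma>) (rev [0..<k])"
    by (simp_all add: FIFO_def lastn_def)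
qed

text \<open>Looking back from the current end of a zigzag walk, the FIFO queue consists of the end of the
  previous leg, as far as not yet evicted, followed by the last \<open>t\<close> pages of the current leg. In
  the next leg all requests but those to these \<open>t\<close> pages are faults.\<close>

definition fifo_queue :: "nat \<Rightarrow> nat \<Rightarrow> nat list" where
  "fifo_queue D t = [D + 1 - (k - t)..<D + 1] @ rev [0..<t]"

lemma length_fifo_queue: "t \<le> k \<Longrightarrow> k \<le> D \<Longrightarrow> length (fifo_queue D t) = k"
  by (auto simp: fifo_queue_def simp del: upt_Suc)

lemma nth_fifo_queue:
  assumes "t \<le> k" "k \<le> D" "m < k"
  shows "fifo_queue D t ! m = (if m < k - t then D + 1 - (k - t) + m else k - 1 - m)"
  using assms unfolding fifo_queue_def by (auto simp: nth_append rev_nth simp del: upt_Suc)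

text \<open>The first \<open>t - 1\<close> requests hit the recent part of the queue. From index
  \<open>t\<close> on all requests fault, since a page of the older part has been evicted by the
  time the leg reaches it.\<close>

lemma fifo_leg:
  fixes e \<sigma> :: int
  assumes "1 \<le> t" "t \<le> k" "k \<le> D" "D < N" "k \<le> d" "d < N" "\<sigma> = 1 \<or> \<sigma> = -1"
  defines "c \<equiv> map (behind e \<sigma>) (fifo_queue D t)" and "leg \<equiv> map (behind e \<sigma>) [1..<Suc d]"
  shows "faults_from (fifo_step k) c leg = Suc d - t"
    "foldl (fifo_step k) c leg =
      map (behind (e - \<sigma> * int d) (-\<sigma>)) (fifo_queue d (min k (Suc d - t)))"
proof -
  let ?q = "behind e \<sigma>"
  have leg: "leg = map ?q [1..<t] @ map ?q [t..<Suc d]"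
    using upt_add_eq_append[of 1 t "Suc d - t"] assms unfolding leg_def
    by (simp del: upt_Suc flip: map_append)
  have "set (map ?q [1..<t]) \<subseteq> set c" unfolding c_def fifo_queue_def by auto
  note hits = fifo_all_hits[OF this, of k]
  \<comment> \<open>The queue and then the faulting requests, as indices behind \<open>e\<close>.
    All are below \<open>N\<close>, so distinct indices mean distinct pages.\<close>
  define idx where "idx = fifo_queue D t @ [t..<Suc d]"
  have lenq: "length (fifo_queue D t) = k" using length_fifo_queue assms(2,3) .
  have len: "length idx = k + (Suc d - t)" unfolding idx_def using lenq by (simp del: upt_Suc)
  have idx: "idx ! m = (if m < k - t then D + 1 - (k - t) + m else if m < k then k - 1 - m
      else m - k + t)" if "m < length idx" for m
    using that nth_fifo_queue[OF assms(2,3)] lenq len unfolding idx_def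
    by (auto simp: nth_append simp del: upt_Suc)
  have split: "c @ map ?q [t..<Suc d] = map ?q idx" by (simp add: idx_def c_def)
  have lastn_c: "lastn k c = c" using lenq by (simp add: lastn_def c_def)
  have "(c @ map ?q [t..<Suc d]) ! j \<noteq> (c @ map ?q [t..<Suc d]) ! i"
    if "length c \<le> i" "i < length (c @ map ?q [t..<Suc d])" "j < i" "i \<le> j + k" for i j
  proof
    have i: "k \<le> i" "i < length idx" "j < length idx"
      using that lenq len unfolding split by (auto simp: c_def)
    assume "(c @ map ?q [t..<Suc d]) ! j = (c @ map ?q [t..<Suc d]) ! i"
    then have "?q (idx ! j) = ?q (idx ! i)" unfolding split using i by simp
    moreover have "set idx \<subseteq> {..<N}"
      unfolding idx_def fifo_queue_def using assms(1-6) by auto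
    then have "idx ! j < N" "idx ! i < N" using i(2,3) nth_mem by blast+
    ultimately have eq: "idx ! j = idx ! i" using behind_inj[OF assms(7)] by simp
    have "idx ! i = i - k + t" using idx[OF i(2)] i(1) by simp
    \<comment> \<open>An index of the older part can recur only \<open>D + 1\<close> places later,
      and \<open>D + 1 > k\<close>.\<close>
    moreover consider "j < k - t" | "k - t \<le> j" "j < k" | "k \<le> j" by linarith
    then have "idx ! j \<noteq> i - k + t"
      by cases (use idx[OF i(3)] i(1) that(3,4) assms(1-4) in auto)
    ultimately show False using eq by simp
  qed
  note faults = fifo_all_faults_nth[OF k_pos this, unfolded lastn_c]
  show "faults_from (fifo_step k) c leg = Suc d - t"
    unfolding leg faults_from_append using hits faults(1) by (simp del: upt_Suc)
  have "foldl (fifo_step k) c leg = lastn k (map ?q idx)"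
    unfolding leg foldl_append using hits faults(2) split by (simp del: upt_Suc)
  also have "\<dots> = map ?q (drop (Suc d - t) idx)" using len by (simp add: lastn_def drop_map)
  \<comment> \<open>As \<open>d \<ge> k\<close>, there are more than \<open>k - t\<close> faults, so
    the older part is gone. Whatever is left of the recent part is the older part for the next
    turn.\<close>
  also have "drop (Suc d - t) idx = map (\<lambda>i. d - i) (fifo_queue d (min k (Suc d - t)))"
  proof (rule nth_equalityI)
    show "length (drop (Suc d - t) idx) = length (map (\<lambda>i. d - i) (fifo_queue d (min k (Suc d - t))))"
      using len length_fifo_queue[of "min k (Suc d - t)" d] assms(5) by simp
    fix m assume m: "m < length (drop (Suc d - t) idx)"
    then have "drop (Suc d - t) idx ! m = idx ! (Suc d - t + m)" using len by simp
    also have "\<dots> = map (\<lambda>i. d - i) (fifo_queue d (min k (Suc d - t))) ! m"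
    proof -
      have "m < k" "m < length (fifo_queue d (min k (Suc d - t)))"
        using m len length_fifo_queue[of "min k (Suc d - t)" d] assms(5) by simp_all
      then show ?thesis
        using len assms(1-6) idx[of "Suc d - t + m"] nth_fifo_queue[of "min k (Suc d - t)" d m]
        by (auto simp: min_def)
    qed
    finally show "drop (Suc d - t) idx ! m =
        map (\<lambda>i. d - i) (fifo_queue d (min k (Suc d - t))) ! m" .
  qed
  also have "map ?q (map (\<lambda>i. d - i) (fifo_queue d (min k (Suc d - t)))) =
      map (behind (e - \<sigma> * int d) (-\<sigma>)) (fifo_queue d (min k (Suc d - t)))"
    unfolding map_map comp_def
    by (rule map_cong[OF refl], rule behind_reverse[symmetric])
      (auto simp: fifo_queue_def simp del: upt_Suc)
  finally show "foldl (fifo_step k) c leg =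
      map (behind (e - \<sigma> * int d) (-\<sigma>)) (fifo_queue d (min k (Suc d - t)))" .
qed

text \<open>A leg of length \<open>d\<close> yields \<open>d + 1 - t\<close> faults for some
  \<open>t \<le> k\<close>, at least the \<open>d - (k - 1)\<close> by which the value
  rises.\<close>

lemma zigzag_FIFO:
  assumes "zigzag J V e \<sigma>"
  shows "V \<le> int (FIFO k J)"
proof -
  have "V \<le> int (FIFO k J) \<and> (\<exists>D t. 1 \<le> t \<and> t \<le> k \<and> k \<le> D \<and> D < N \<and>
      foldl (fifo_step k) [] J = map (behind e \<sigma>) (fifo_queue D t))"
    using assms
  proof (induction rule: zigzag.induct)
    case (run L \<sigma> e)
    \<comment> \<open>With \<open>t = k\<close> the older part is empty whatever \<open>D\<close>
      is; \<open>D = k\<close> is in the required range.\<close>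
    have "foldl (fifo_step k) [] (map (behind e \<sigma>) (rev [0..<L])) = map (behind e \<sigma>) (fifo_queue k k)"
      using fifo_run(2)[OF run] by (simp add: fifo_queue_def)
    then show ?case using fifo_run(1)[OF run] k_pos k_less by force
  next
    case (turn J V e \<sigma> d)
    then obtain D t where t: "1 \<le> t" "t \<le> k" "k \<le> D" "D < N"
      and c: "foldl (fifo_step k) [] J = map (behind e \<sigma>) (fifo_queue D t)" by blast
    note leg = fifo_leg[OF t turn.hyps(2,3) zigzag_dir[OF turn.hyps(1)], of e]
    have "FIFO k (J @ map (behind e \<sigma>) [1..<Suc d]) = FIFO k J + (Suc d - t)"
      unfolding FIFO_def faults_from_append c leg(1) ..
    moreover have "foldl (fifo_step k) [] (J @ map (behind e \<sigma>) [1..<Suc d]) =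
        map (behind (e - \<sigma> * int d) (-\<sigma>)) (fifo_queue d (min k (Suc d - t)))"
      unfolding foldl_append c leg(2) ..
    moreover have "1 \<le> min k (Suc d - t)" "min k (Suc d - t) \<le> k" "int (Suc d - t) \<ge> int d - (int k - 1)"
      using t turn.hyps k_pos by auto
    ultimately show ?case using turn by (intro conjI exI[of _ d] exI[of _ "min k (Suc d - t)"]) auto
  qed
  then show ?thesis by blast
qed

section \<open>The zigzag walk that shadows a given walk\<close>

text \<open>\<open>shadow I p V w\<close>: a zigzag walk made of requests of \<open>I\<close> accompanies the walk \<open>I\<close>, which is at
  \<open>p\<close>, such that the last \<open>k\<close> positions of the former are the window starting at \<open>w\<close>. The
  pages \<open>behind e \<sigma> 1, \<dots>, behind e \<sigma> h\<close> have been requested since but not been used; they suffice for a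
  turn as soon as \<open>I\<close> leaves the window on the other side.\<close>

definition shadow :: "nat list \<Rightarrow> int \<Rightarrow> int \<Rightarrow> int \<Rightarrow> bool" where
  "shadow I p V w \<longleftrightarrow> (\<exists>J e \<sigma> u h. zigzag J V e \<sigma> \<and> p = e - \<sigma> * int u \<and> u \<le> h \<and> h < k \<and>
     mset J + mset (map (behind e \<sigma>) [1..<Suc h]) \<subseteq># mset I \<and> set I \<subseteq> set J \<and>
     w = (if \<sigma> = 1 then e - int k + 1 else e))"

text \<open>Inside its window the shadow waits and collects pages. A step beyond \<open>e\<close>
  prolongs the zigzag walk; a step out on the other side completes a new leg. The term
  \<open>\<bar>w' - (w + \<delta>)\<bar>\<close> accounts for a jump of the window when a lap is cut
  out.\<close>

lemma shadow_step:
  assumes "shadow I p V w" "\<bar>\<delta>\<bar> \<le> 1"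
  defines "I' \<equiv> I @ [page (p + \<delta>)]"
  shows "(w \<le> p + \<delta> \<and> p + \<delta> \<le> w + int k - 1 \<and> shadow I' (p + \<delta>) V w) \<or>
    (\<not> (w \<le> p + \<delta> \<and> p + \<delta> \<le> w + int k - 1) \<and>
      (\<exists>V' w'. shadow I' (p + \<delta>) V' w' \<and> V' \<ge> V + 1 + \<bar>w' - (w + \<delta>)\<bar>))"
proof -
  obtain J e \<sigma> u h where J: "zigzag J V e \<sigma>" and p: "p = e - \<sigma> * int u" and u: "u \<le> h" "h < k"
    and sub: "mset J + mset (map (behind e \<sigma>) [1..<Suc h]) \<subseteq># mset I" and set: "set I \<subseteq> set J"
    and w: "w = (if \<sigma> = 1 then e - int k + 1 else e)"
    using assms(1) unfolding shadow_def by blast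
  have \<sigma>: "\<sigma> = 1 \<or> \<sigma> = -1" using zigzag_dir[OF J] .
  have m: "mset I' = add_mset (page (p + \<delta>)) (mset I)" by (simp add: I'_def)
  have subI: "mset I \<subseteq># mset I'" unfolding I'_def mset_append by (rule mset_subset_eq_add_left)
  \<comment> \<open>\<open>h\<close> grows when the walk is farther behind \<open>e\<close> than
    ever since the last update; this request is collected.\<close>
  have inside: "?thesis"
    if u': "p + \<delta> = e - \<sigma> * int u'" "u' \<le> h'" "h' < k" "h' = h \<or> (h' = Suc h \<and> u' = h')" for u' h'
  proof -
    have "page (p + \<delta>) = behind e \<sigma> u'" using u' by (simp add: behind_def)
    then have "set I' \<subseteq> set J" using zigzag_window[OF J, of u'] u' set by (simp add: I'_def)
    moreover have "mset J + mset (map (behind e \<sigma>) [1..<Suc h']) \<subseteq># mset I'"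
    proof (cases "h' = h")
      case True
      then show ?thesis using sub subI subset_mset.order_trans by blast
    next
      case False
      then have "h' = Suc h" "u' = Suc h" using u' by auto
      then show ?thesis using sub \<open>page (p + \<delta>) = behind e \<sigma> u'\<close> unfolding m by simp
    qed
    ultimately have "shadow I' (p + \<delta>) V w"
      unfolding shadow_def using J u' w by blast
    moreover have "w \<le> p + \<delta> \<and> p + \<delta> \<le> w + int k - 1" using w u' \<sigma> by auto
    ultimately show ?thesis by blast
  qed
  \<comment> \<open>At a new end \<open>h\<close> restarts at 0, and collected requests that
    \<open>J'\<close> does not use are given up.\<close>
  have outside: "?thesis"
    if "zigzag J' V' (p + \<delta>) \<sigma>'" "mset J' \<subseteq># mset I'" "mset J \<subseteq># mset J'"
      "page (p + \<delta>) \<in># mset J'" "\<not> (w \<le> p + \<delta> \<and> p + \<delta> \<le> w + int k - 1)"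
      "V' \<ge> V + 1 + \<bar>(if \<sigma>' = 1 then p + \<delta> - int k + 1 else p + \<delta>) - (w + \<delta>)\<bar>" for J' V' \<sigma>'
  proof -
    have "set I' \<subseteq> set J'" using set that(3,4) set_mset_mono[OF that(3)] by (auto simp: I'_def)
    then have "shadow I' (p + \<delta>) V' (if \<sigma>' = 1 then p + \<delta> - int k + 1 else p + \<delta>)"
      unfolding shadow_def using that(1,2) k_pos
      by (intro exI[of _ J'] exI[of _ "p + \<delta>"] exI[of _ \<sigma>'] exI[of _ 0]) auto
    then show ?thesis using that(5,6) by blast
  qed
  have subJ: "mset J \<subseteq># mset I" using sub subset_mset.order_trans mset_subset_eq_add_left by blast
  have "\<delta> = 0 \<or> \<delta> = \<sigma> \<or> \<delta> = -\<sigma>" using assms(2) \<sigma> by linarith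
  moreover have "u < h \<or> u = h" "Suc h < k \<or> Suc h = k" "u = 0 \<or> u > 0" using u by auto
  \<comment> \<open>In turn: staying, returning towards \<open>e\<close>, leaving beyond
    \<open>e\<close>, moving back over collected pages, collecting a new page, leaving on the far
    side.\<close>
  ultimately consider "\<delta> = 0" | "\<delta> = \<sigma>" "u > 0" | "\<delta> = \<sigma>" "u = 0" | "\<delta> = -\<sigma>" "u < h"
    | "\<delta> = -\<sigma>" "u = h" "Suc h < k" | "\<delta> = -\<sigma>" "u = h" "Suc h = k"
    by blast
  then show ?thesis
  proof cases
    case 1
    then have "p + \<delta> = e - \<sigma> * int u" using p by simp
    then show ?thesis by (rule inside[of _ h]) (use u in auto)
  next
    case 2
    then have "p + \<delta> = e - \<sigma> * int (u - 1)" using p by (simp add: of_nat_diff algebra_simps)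
    then show ?thesis by (rule inside[of _ h]) (use u in auto)
  next
    case 3
    obtain J' V' \<sigma>' where J': "zigzag J' V' (e + \<sigma>) \<sigma>'"
      "mset J' = add_mset (page (e + \<sigma>)) (mset J)"
      "\<sigma>' = \<sigma> \<and> V' = V + 1 \<or> \<sigma>' = -\<sigma> \<and> V' = V + int k"
      using zigzag_straight[OF J] by blast
    have pd: "p + \<delta> = e + \<sigma>" using 3 p by simp
    show ?thesis
    proof (rule outside)
      show "zigzag J' V' (p + \<delta>) \<sigma>'" using J'(1) pd by simp
      show "mset J' \<subseteq># mset I'" unfolding m J'(2) pd using subJ by simp
      show "mset J \<subseteq># mset J'" "page (p + \<delta>) \<in># mset J'" unfolding J'(2) pd by auto
      show "\<not> (w \<le> p + \<delta> \<and> p + \<delta> \<le> w + int k - 1)" using w pd \<sigma> by auto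
      \<comment> \<open>If a lap was cut out, the window lies on the other side of its end,
        \<open>k - 1\<close> away from \<open>w + \<delta>\<close>; the gain of \<open>k\<close>
        pays for this and the fault.\<close>
      show "V' \<ge> V + 1 + \<bar>(if \<sigma>' = 1 then p + \<delta> - int k + 1 else p + \<delta>) - (w + \<delta>)\<bar>"
        using J'(3) w pd \<sigma> 3 k_pos by auto
    qed
  next
    case 4
    then have "p + \<delta> = e - \<sigma> * int (Suc u)" using p by (simp add: algebra_simps)
    then show ?thesis by (rule inside[of _ h]) (use u 4 in auto)
  next
    case 5
    then have "p + \<delta> = e - \<sigma> * int (Suc u)" using p by (simp add: algebra_simps)
    then show ?thesis by (rule inside[of _ "Suc h"]) (use u 5 in auto)
  next
    case 6
    \<comment> \<open>Now \<open>k - 1\<close> pages are collected, and the new request completes a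
      leg of the least length \<open>k\<close>, worth one fault.\<close>
    have pd: "p + \<delta> = e - \<sigma> * int k" using 6 p by (simp add: algebra_simps flip: 6(3))
    let ?J = "J @ map (behind e \<sigma>) [1..<Suc k]"
    have mJ: "mset ?J = add_mset (page (p + \<delta>)) (mset J + mset (map (behind e \<sigma>) [1..<Suc h]))"
      unfolding pd 6(3)[symmetric] by (simp add: behind_def)
    show ?thesis
    proof (rule outside)
      show "zigzag ?J (V + 1) (p + \<delta>) (-\<sigma>)"
      proof -
        have "V + 1 = V + int k - (int k - 1)" by simp
        then show ?thesis unfolding pd using zigzag.turn[OF J order_refl k_less] by (simp only:)
      qed
      show "mset ?J \<subseteq># mset I'" unfolding m mJ using sub by simp
      show "mset J \<subseteq># mset ?J" "page (p + \<delta>) \<in># mset ?J" unfolding mJ by auto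
      show "\<not> (w \<le> p + \<delta> \<and> p + \<delta> \<le> w + int k - 1)" using w pd \<sigma> k_pos by auto
      show "V + 1 \<ge> V + 1 + \<bar>(if -\<sigma> = 1 then p + \<delta> - int k + 1 else p + \<delta>) - (w + \<delta>)\<bar>"
        using w pd \<sigma> 6 by auto
    qed
  qed
qed

section \<open>Comparison of the LRU window with the shadow's window\<close>

abbreviation lru_cache :: "nat list \<Rightarrow> nat list" where
  "lru_cache I \<equiv> foldl (lru_step k) [] I"

lemma LRU_snoc: "LRU k (I @ [v]) = LRU k I + (if v \<in> set (lru_cache I) then 0 else 1)"
  by (simp add: LRU_def faults_from_append)

text \<open>Two windows pushed by the same walk come no farther apart; a discrepancy is paid for by
  a fault.\<close>

definition tracked :: "nat list \<Rightarrow> int \<Rightarrow> bool" where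
  "tracked I p \<longleftrightarrow> (\<exists>a V w. lru_window a (a + int k - 1) p (lru_cache I) \<and> shadow I p V w \<and>
     int (LRU k I) + \<bar>w - a\<bar> \<le> V)"

lemma shadow_position: "shadow I p V w \<Longrightarrow> w \<le> p \<and> p \<le> w + int k - 1"
  unfolding shadow_def using zigzag_dir by fastforce

text \<open>If only the shadow is pushed, the windows separate by at most 1 plus the jump, and
  \<open>V\<close> rises by as much. If only LRU is pushed, the windows approach, which pays for the
  fault. If both are, they move in parallel up to the jump.\<close>

lemma tracked_step:
  assumes "tracked I p" "\<bar>\<delta>\<bar> \<le> 1"
  shows "tracked (I @ [page (p + \<delta>)]) (p + \<delta>)"
proof -
  let ?I = "I @ [page (p + \<delta>)]"
  obtain a V w where a: "lru_window a (a + int k - 1) p (lru_cache I)" "shadow I p V w"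
    and V: "int (LRU k I) + \<bar>w - a\<bar> \<le> V" using assms(1) unfolding tracked_def by blast
  have pos: "a \<le> p" "p \<le> a + int k - 1" "w \<le> p" "p \<le> w + int k - 1"
    using a(1) shadow_position[OF a(2)] by (auto simp: lru_window_def)
  obtain a' where a': "lru_window a' (a' + int k - 1) (p + \<delta>) (lru_cache ?I)"
    "(a \<le> p + \<delta> \<and> p + \<delta> \<le> a + int k - 1 \<and> LRU k ?I = LRU k I \<and> a' = a) \<or>
     (\<not> (a \<le> p + \<delta> \<and> p + \<delta> \<le> a + int k - 1) \<and> LRU k ?I = LRU k I + 1 \<and> a' = a + \<delta>)"
  proof (cases "a \<le> p + \<delta> \<and> p + \<delta> \<le> a + int k - 1")
    case True
    then show thesis
      using that[of a] lru_window_hit[OF a(1) _ assms(2)] by (simp add: LRU_snoc)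
  next
    case False
    have eq: "a + int k - 1 + \<delta> = a + \<delta> + int k - 1" by simp
    show thesis
      using that[of "a + \<delta>"] lru_window_fault(1,3)[OF a(1) _ assms(2) False, unfolded eq] False
      by (simp add: LRU_snoc)
  qed
  obtain V' w' where w': "shadow ?I (p + \<delta>) V' w'"
    "(w \<le> p + \<delta> \<and> p + \<delta> \<le> w + int k - 1 \<and> V' = V \<and> w' = w) \<or>
     (\<not> (w \<le> p + \<delta> \<and> p + \<delta> \<le> w + int k - 1) \<and> V' \<ge> V + 1 + \<bar>w' - (w + \<delta>)\<bar>)"
    using shadow_step[OF a(2) assms(2)] by blast
  have "int (LRU k ?I) + \<bar>w' - a'\<bar> \<le> V'"
    using a'(2) w'(2)
  proof (elim disjE conjE)
    assume "a \<le> p + \<delta>" "p + \<delta> \<le> a + int k - 1" "LRU k ?I = LRU k I" "a' = a" "V' = V" "w' = w"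
    then show ?thesis using V by simp
  next
    assume "LRU k ?I = LRU k I" "a' = a" "V' \<ge> V + 1 + \<bar>w' - (w + \<delta>)\<bar>"
    then show ?thesis using V assms(2) by linarith
  next
    assume "\<not> (a \<le> p + \<delta> \<and> p + \<delta> \<le> a + int k - 1)" "LRU k ?I = LRU k I + 1" "a' = a + \<delta>"
      "w \<le> p + \<delta>" "p + \<delta> \<le> w + int k - 1" "V' = V" "w' = w"
    \<comment> \<open>Leaving one window but not the other reveals which of them lies farther in
      direction \<open>\<delta>\<close>.\<close>
    moreover from this have "\<delta> = 1 \<and> a < w \<or> \<delta> = -1 \<and> w < a" using pos assms(2) by linarith
    ultimately show ?thesis using V by linarith
  next
    assume "LRU k ?I = LRU k I + 1" "a' = a + \<delta>" "V' \<ge> V + 1 + \<bar>w' - (w + \<delta>)\<bar>"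
    then show ?thesis using V by linarith
  qed
  then show ?thesis unfolding tracked_def using a'(1) w'(1) by blast
qed

text \<open>The phase before the first eviction: the cache is the whole range of the walk, at one
  fault per position.\<close>

definition cold :: "nat list \<Rightarrow> int \<Rightarrow> bool" where
  "cold I p \<longleftrightarrow> (\<exists>a b. lru_window a b p (lru_cache I) \<and> b - a < int k \<and>
     set I = page ` {a..b} \<and> int (LRU k I) = b - a + 1)"

lemma distinct_mset_subset:
  "distinct xs \<Longrightarrow> set xs \<subseteq> set ys \<Longrightarrow> mset xs \<subseteq># mset ys"
  by (metis List.finite_set mset_set_set mset_set_set_mset_msubset set_mset_mset subset_imp_msubset_mset_set
      subset_mset.order_trans)

text \<open>From an end of the full window its \<open>k\<close> pages form a straight run ending at
  \<open>p\<close>. Its value \<open>k\<close> is the number of faults so far, and both windows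
  coincide.\<close>

lemma tracked_if_full:
  assumes "lru_window a b p (lru_cache I)" "b - a + 1 = int k" "set I = page ` {a..b}"
    "int (LRU k I) = int k" "p = a \<or> p = b"
  shows "tracked I p"
proof -
  define \<sigma> :: int where "\<sigma> = (if p = b then 1 else -1)"
  have \<sigma>: "\<sigma> = 1 \<or> \<sigma> = -1" by (simp add: \<sigma>_def)
  let ?J = "map (behind p \<sigma>) (rev [0..<k])"
  have "behind p \<sigma> ` {0..<k} = page ` {a..b}"
  proof -
    have "(\<lambda>i. p - \<sigma> * int i) ` {0..<k} = {a..b}"
    proof (intro equalityI subsetI)
      fix x assume "x \<in> {a..b}"
      then have "x = p - \<sigma> * int (nat \<bar>x - p\<bar>)" "nat \<bar>x - p\<bar> < k"
        using assms(2,5) by (auto simp: \<sigma>_def)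
      then show "x \<in> (\<lambda>i. p - \<sigma> * int i) ` {0..<k}" by (metis atLeastLessThan_iff imageI zero_le)
    qed (use assms(2,5) in \<open>auto simp: \<sigma>_def split: if_splits\<close>)
    then show ?thesis unfolding behind_def by (metis image_image)
  qed
  then have set: "set ?J = set I" using assms(3) by simp
  have "inj_on (behind p \<sigma>) {0..<k}"
    by (rule inj_onI) (use behind_inj[OF \<sigma>] k_less in auto)
  then have "distinct ?J" by (simp add: distinct_map)
  then have sub: "mset ?J \<subseteq># mset I" using set by (intro distinct_mset_subset) auto
  have "shadow I p (int k) a"
    unfolding shadow_def
  proof (intro exI conjI)
    show "zigzag ?J (int k) p \<sigma>" by (rule zigzag.run[OF order_refl \<sigma>])
    show "mset ?J + mset (map (behind p \<sigma>) [1..<Suc 0]) \<subseteq># mset I" using sub by simp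
    show "a = (if \<sigma> = 1 then p - int k + 1 else p)" using assms(2,5) by (auto simp: \<sigma>_def)
  qed (use k_pos set in auto)
  moreover have "lru_window a (a + int k - 1) p (lru_cache I)"
  proof -
    have "b = a + int k - 1" using assms(2) by simp
    then show ?thesis using assms(1) by simp
  qed
  ultimately show ?thesis unfolding tracked_def using assms(4) by force
qed

lemma cold_step:
  assumes "cold I p" "\<bar>\<delta>\<bar> \<le> 1"
  shows "cold (I @ [page (p + \<delta>)]) (p + \<delta>) \<or> tracked (I @ [page (p + \<delta>)]) (p + \<delta>)"
proof -
  let ?x = "p + \<delta>"
  obtain a b where ab: "lru_window a b p (lru_cache I)" "b - a < int k"
    "set I = page ` {a..b}" "int (LRU k I) = b - a + 1" using assms(1) unfolding cold_def by blast
  have p: "a \<le> p" "p \<le> b" using ab(1) by (auto simp: lru_window_def)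
  show ?thesis
  proof (cases "a \<le> ?x \<and> ?x \<le> b")
    case True
    then have "cold (I @ [page ?x]) ?x"
      unfolding cold_def using lru_window_hit[OF ab(1,2) assms(2)] ab(2-4)
      by (intro exI[of _ a] exI[of _ b]) (auto simp: LRU_snoc)
    then show ?thesis ..
  next
    case False
    note fault = lru_window_fault[OF ab(1,2) assms(2) False]
    have ends: "\<delta> = 1 \<and> p = b \<or> \<delta> = -1 \<and> p = a" using False p assms(2) by linarith
    show ?thesis
    proof (cases "b - a + 1 < int k")
      case True
      have "{min a ?x..max b ?x} = insert ?x {a..b}" using ends p by auto
      then have "set (I @ [page ?x]) = page ` {min a ?x..max b ?x}" using ab(3) by simp
      moreover have "max b ?x - min a ?x < int k"
        "int (LRU k (I @ [page ?x])) = max b ?x - min a ?x + 1"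
        using True ends p fault(1) ab(4) by (auto simp: LRU_snoc)
      ultimately have "cold (I @ [page ?x]) ?x"
        unfolding cold_def using fault(2)[OF True] by auto
      then show ?thesis ..
    next
      case False
      \<comment> \<open>The shadow is started at \<open>p\<close>, just before the step that
        overflows the window.\<close>
      then have "tracked I p" using tracked_if_full[OF ab(1) _ ab(3)] ab(2,4) ends by auto
      then show ?thesis using tracked_step assms(2) by blast
    qed
  qed
qed

lemma cold_or_tracked:
  assumes "respects_graph (cycle_graph N) I" "I \<noteq> []"
  shows "\<exists>p. page p = last I \<and> (cold I p \<or> tracked I p)"
  using assms
proof (induction I rule: rev_induct)
  case (snoc v I)
  have v: "v < N" using snoc.prems by (auto simp: respects_graph_def cycle_graph_def)
  show ?case
  proof (cases "I = []")
    case True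
    have pv: "page (int v) = v" using page_of_nat v by simp
    have "lru_cache [v] = [v]" using k_pos by (simp add: lru_step_def insert_page_def)
    then have "lru_window (int v) (int v) (int v) (lru_cache [v])"
      unfolding lru_window_def using pv by (intro conjI exI[of _ "[int v]"]) auto
    then have "cold [v] (int v)" unfolding cold_def using k_pos pv
      by (intro exI[of _ "int v"]) (auto simp: LRU_def)
    then show ?thesis using True pv by auto
  next
    case False
    have "respects_graph (cycle_graph N) I" "adjacent (last I) v"
      using snoc.prems False by (auto simp: respects_graph_def successively_append_iff)
    then obtain p where p: "page p = last I" "cold I p \<or> tracked I p" using snoc.IH False by blast
    then obtain \<delta> where "\<delta> = -1 \<or> \<delta> = 0 \<or> \<delta> = 1" "v = page (p + \<delta>)"
      using adjacent_lift[of p v] v \<open>adjacent (last I) v\<close> by auto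
    moreover from this have "\<bar>\<delta>\<bar> \<le> 1" by auto
    ultimately show ?thesis
      using p(2) cold_step[of I p \<delta>] tracked_step[of I p \<delta>]
      by (intro exI[of _ "p + \<delta>"]) (simp only: last_snoc simp_thms, blast)
  qed
qed simp

section \<open>From shadows to reorderings of the requests\<close>

text \<open>With more than \<open>k\<close> pages the walk is no longer cold, so it has a shadow.
  Its zigzag walk uses requests of \<open>I\<close> only and satisfies
  \<open>LRU k I \<le> V \<le> FIFO k J\<close>; padding by hits uses up the rest.\<close>

lemma LRU_le_FIFO_of_permutation:
  assumes "respects_graph (cycle_graph N) I"
  shows "\<exists>J. mset J = mset I \<and> respects_graph (cycle_graph N) J \<and> LRU k I \<le> FIFO k J"
proof (cases "card (set I) \<le> k")
  case True
  then show ?thesis using LRU_eq_FIFO_if_few_pages[of I k] assms by auto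
next
  case False
  then have "I \<noteq> []" by auto
  then obtain p where "cold I p \<or> tracked I p" using cold_or_tracked assms by blast
  moreover have "\<not> cold I p"
  proof
    assume "cold I p"
    then obtain a b where "b - a < int k" "set I = page ` {a..b}" unfolding cold_def by blast
    then have "card (set I) \<le> k" using card_image_le[of "{a..b}" page] by simp
    then show False using False by simp
  qed
  ultimately obtain a V w where "shadow I p V w" "int (LRU k I) + \<bar>w - a\<bar> \<le> V"
    unfolding tracked_def by blast
  then obtain J e \<sigma> M where J: "zigzag J V e \<sigma>" "mset J + M \<subseteq># mset I" "set I \<subseteq> set J"
    unfolding shadow_def by blast
  have "mset J \<subseteq># mset I" using J(2) subset_mset.order_trans mset_subset_eq_add_left by blast
  then obtain J' where "mset J' = mset I" "respects_graph (cycle_graph N) J'" "FIFO k J' = FIFO k J"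
    using pad_with_hits[of J I "cycle_graph N" k] J(3) zigzag_respects[OF J(1)] by blast
  moreover have "LRU k I \<le> FIFO k J"
    using zigzag_FIFO[OF J(1)] \<open>int (LRU k I) + \<bar>w - a\<bar> \<le> V\<close> by linarith
  ultimately show ?thesis by auto
qed

end

theorem theorem3:
  fixes N k :: nat and I :: "nat list"
  assumes "k \<ge> 1"
    and "respects_graph (cycle_graph N) I"
  shows "worst_order (LRU k) (cycle_graph N) I \<le> worst_order (FIFO k) (cycle_graph N) I"
proof (rule worst_order_mono[OF assms(2)])
  fix I' assume I': "respects_graph (cycle_graph N) I'" "mset I' = mset I"
  have "\<exists>J. mset J = mset I' \<and> respects_graph (cycle_graph N) J \<and> LRU k I' \<le> FIFO k J"
  proof (cases "k < N")
    case True
    then interpret cycle_paging N k using assms(1) by unfold_locales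
    show ?thesis using LRU_le_FIFO_of_permutation I'(1) .
  next
    case False
    have "set I' \<subseteq> {..<N}" using I'(1) by (simp add: respects_graph_def cycle_graph_def)
    then have "card (set I') \<le> k" using False card_mono[of "{..<N}" "set I'"] by simp
    then show ?thesis using LRU_eq_FIFO_if_few_pages[of I' k] I'(1) by auto
  qed
  then show "\<exists>J. mset J = mset I \<and> respects_graph (cycle_graph N) J \<and> LRU k I' \<le> FIFO k J"
    using I'(2) by simp
qed

end
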